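(* Let $G$ be an abelian group (written additively), let $\alpha\in\mathrm{Aut}(G)$ satisfy $\alpha^2=1$, and let $G_\alpha=(G,\cdot)$ be the AG-group with operation $a\cdot b:=\alpha(a)+b$. Suppose $G_\alpha$ is non-associative, that is, $\alpha$ is not the identity. Then the multiplication group $M(G_\alpha)$ is isomorphic to the semidirect product $G\rtimes\langle\alpha\rangle$ (with the natural action of $\langle\alpha\rangle\le\mathrm{Aut}(G)$ on $G$). Moreover, the order two group $\langle\alpha\rangle$ is the inner mapping group of $G_\alpha$, that is, the stabilizer in $M(G_\alpha)$ of the left identity element $0$ of $G_\alpha$.
   Context: An AG-group is a set with a binary operation satisfying the left invertive law $(xy)z=(zy)x$ and having a left identity and left inverses; every AG-group is a quasigroup (all left and right translations are bijections). For a quasigroup $Q$ and $x\in Q$, the left translation is $L_x:Q\to Q$, $L_x(z)=xz$, and the right translation is $R_x:Q\to Q$, $R_x(z)=zx$. The multiplication group $M(Q)$ is the subgroup of the symmetric group $\mathrm{Sym}(Q)$ generated by all left and right translations. The automorphism $\alpha$ is viewed as a permutation of the set $G$, i.e. as an element of $\mathrm{Sym}(G)$. *)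

theory Defs
  imports "HOL-Algebra.Algebra"
begin

definition left_translation :: "('a, 'b) monoid_scheme \<Rightarrow> 'a \<Rightarrow> 'a \<Rightarrow> 'a" where
  "left_translation Q x = (\<lambda>z\<in>carrier Q. x \<otimes>\<^bsub>Q\<^esub> z)"

definition right_translation :: "('a, 'b) monoid_scheme \<Rightarrow> 'a \<Rightarrow> 'a \<Rightarrow> 'a" where
  "right_translation Q x = (\<lambda>z\<in>carrier Q. z \<otimes>\<^bsub>Q\<^esub> x)"

locale quasigroup =
  fixes Q (structure)
  assumes left_translation_Bij: "x \<in> carrier Q \<Longrightarrow> left_translation Q x \<in> Bij (carrier Q)"
    and right_translation_Bij: "x \<in> carrier Q \<Longrightarrow> right_translation Q x \<in> Bij (carrier Q)"

text \<open>Associativity is not assumed: only the record type is taken from monoids. The field \<^const>\<open>monoid.one\<close> holds the left identity.\<close>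

locale AG_group =
  fixes Q (structure)
  assumes m_closed: "\<lbrakk>x \<in> carrier Q; y \<in> carrier Q\<rbrakk> \<Longrightarrow> x \<otimes> y \<in> carrier Q"
    and one_closed: "\<one> \<in> carrier Q"
    and left_invertive:
      "\<lbrakk>x \<in> carrier Q; y \<in> carrier Q; z \<in> carrier Q\<rbrakk> \<Longrightarrow> (x \<otimes> y) \<otimes> z = (z \<otimes> y) \<otimes> x"
    and l_one: "x \<in> carrier Q \<Longrightarrow> \<one> \<otimes> x = x"
    and l_inv_ex: "x \<in> carrier Q \<Longrightarrow> \<exists>y\<in>carrier Q. y \<otimes> x = \<one>"

definition multiplication_group :: "('a, 'b) monoid_scheme \<Rightarrow> ('a \<Rightarrow> 'a) monoid" where
  "multiplication_group Q =
     BijGroup (carrier Q)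
       \<lparr>carrier := generate (BijGroup (carrier Q))
          (left_translation Q ` carrier Q \<union> right_translation Q ` carrier Q)\<rparr>"

definition inner_mapping_group :: "('a, 'b) monoid_scheme \<Rightarrow> ('a \<Rightarrow> 'a) set" where
  "inner_mapping_group Q = stabilizer (multiplication_group Q) (\<lambda>f. f) \<one>\<^bsub>Q\<^esub>"

definition associative_on_carrier :: "('a, 'b) monoid_scheme \<Rightarrow> bool" where
  "associative_on_carrier Q \<longleftrightarrow>
     (\<forall>x\<in>carrier Q. \<forall>y\<in>carrier Q. \<forall>z\<in>carrier Q.
        (x \<otimes>\<^bsub>Q\<^esub> y) \<otimes>\<^bsub>Q\<^esub> z = x \<otimes>\<^bsub>Q\<^esub> (y \<otimes>\<^bsub>Q\<^esub> z))"

text \<open>The abelian group is written multiplicatively, so \<open>\<alpha>(a) + b\<close> becomes \<open>\<alpha> a \<otimes> b\<close>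
  and its neutral element \<open>0\<close> is \<open>\<one>\<close>.\<close>

definition AG_of :: "('a, 'b) monoid_scheme \<Rightarrow> ('a \<Rightarrow> 'a) \<Rightarrow> 'a monoid" where
  "AG_of G \<alpha> = \<lparr>carrier = carrier G, monoid.mult = \<lambda>a b. \<alpha> a \<otimes>\<^bsub>G\<^esub> b, monoid.one = \<one>\<^bsub>G\<^esub>\<rparr>"

definition semidirect_product ::
    "('a, 'b) monoid_scheme \<Rightarrow> ('c, 'd) monoid_scheme \<Rightarrow> ('c \<Rightarrow> 'a \<Rightarrow> 'a) \<Rightarrow> ('a \<times> 'c) monoid" where
  "semidirect_product N H \<phi> =
     \<lparr>carrier = carrier N \<times> carrier H,
      monoid.mult = \<lambda>(n, h) (n', h'). (n \<otimes>\<^bsub>N\<^esub> \<phi> h n', h \<otimes>\<^bsub>H\<^esub> h'),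
      monoid.one = (\<one>\<^bsub>N\<^esub>, \<one>\<^bsub>H\<^esub>)\<rparr>"

definition cyclic_aut_group :: "('a, 'b) monoid_scheme \<Rightarrow> ('a \<Rightarrow> 'a) \<Rightarrow> ('a \<Rightarrow> 'a) monoid" where
  "cyclic_aut_group G \<alpha> = AutoGroup G \<lparr>carrier := generate (AutoGroup G) {\<alpha>}\<rparr>"

lemma (in AG_group) is_quasigroup: "quasigroup Q"
proof -
  have inv_r: "(z \<otimes> x) \<otimes> y = z" if "x \<in> carrier Q" "y \<in> carrier Q" "z \<in> carrier Q" "y \<otimes> x = \<one>"
    for x y z
    using that left_invertive[of z x y] l_one by simp
  have R: "bij_betw (\<lambda>z. z \<otimes> x) (carrier Q) (carrier Q)" if x: "x \<in> carrier Q" for x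
  proof -
    obtain y where y: "y \<in> carrier Q" "y \<otimes> x = \<one>" using l_inv_ex x by blast
    obtain w where w: "w \<in> carrier Q" "w \<otimes> y = \<one>" using l_inv_ex y by blast
    have 1: "(z \<otimes> x) \<otimes> y = z" if "z \<in> carrier Q" for z
      using inv_r x y that by blast
    have 2: "(z \<otimes> y) \<otimes> w = z" if "z \<in> carrier Q" for z
      using inv_r y w that by blast
    have "(z \<otimes> y) \<otimes> x = z" if z: "z \<in> carrier Q" for z
      using 1[of "z \<otimes> y"] 2[of "(z \<otimes> y) \<otimes> x"] 2[of z] 1 m_closed x y z
      by (metis)
    with 1 show ?thesis
      by (intro bij_betwI[where g = "\<lambda>z. z \<otimes> y"]) (auto simp: m_closed x y)
  qed
  have L: "bij_betw (\<lambda>z. x \<otimes> z) (carrier Q) (carrier Q)" if x: "x \<in> carrier Q" for x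
  proof -
    have "x \<otimes> z = (z \<otimes> x) \<otimes> \<one>" if "z \<in> carrier Q" for z
      using left_invertive[of \<one> x z] l_one x that one_closed by simp
    with bij_betw_trans[OF R[OF x] R[OF one_closed]] show ?thesis
      by (subst bij_betw_cong[where g = "(\<lambda>z. z \<otimes> \<one>) \<circ> (\<lambda>z. z \<otimes> x)"]) auto
  qed
  from L R show ?thesis
    by unfold_locales (simp_all add: left_translation_def right_translation_def Bij_def)
qed

lemma semidirect_product_group:
  assumes N: "group N" and H: "group H" and \<phi>: "\<phi> \<in> hom H (AutoGroup N)"
  shows "group (semidirect_product N H \<phi>)"
proof -
  interpret N: group N by fact
  interpret H: group H by fact
  have aut: "\<phi> h \<in> auto N" if "h \<in> carrier H" for h
    using \<phi> that by (auto simp: hom_def AutoGroup_def)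
  have cl: "\<phi> h n \<in> carrier N" if "h \<in> carrier H" "n \<in> carrier N" for h n
    using aut[OF that(1)] that(2) by (auto simp: auto_def hom_def)
  have mu: "\<phi> h (n \<otimes>\<^bsub>N\<^esub> n') = \<phi> h n \<otimes>\<^bsub>N\<^esub> \<phi> h n'"
    if "h \<in> carrier H" "n \<in> carrier N" "n' \<in> carrier N" for h n n'
    using aut[OF that(1)] that(2,3) by (auto simp: auto_def hom_def)
  have co: "\<phi> (h \<otimes>\<^bsub>H\<^esub> h') n = \<phi> h (\<phi> h' n)"
    if "h \<in> carrier H" "h' \<in> carrier H" "n \<in> carrier N" for h h' n
  proof -
    have "\<phi> (h \<otimes>\<^bsub>H\<^esub> h') = compose (carrier N) (\<phi> h) (\<phi> h')"
      using \<phi> aut[OF that(1)] aut[OF that(2)] that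
      by (auto simp: hom_def AutoGroup_def BijGroup_def auto_def)
    then show ?thesis using that(3) by (simp add: compose_def)
  qed
  have "\<phi> \<one>\<^bsub>H\<^esub> = \<one>\<^bsub>AutoGroup N\<^esub>"
    using hom_one[OF \<phi> H N.AutoGroup] .
  then have on: "\<phi> \<one>\<^bsub>H\<^esub> n = n" if "n \<in> carrier N" for n
    using that by (simp add: AutoGroup_def BijGroup_def)
  show ?thesis
  proof (rule groupI)
    fix x y z
    assume "x \<in> carrier (semidirect_product N H \<phi>)" "y \<in> carrier (semidirect_product N H \<phi>)"
      "z \<in> carrier (semidirect_product N H \<phi>)"
    then show "x \<otimes>\<^bsub>semidirect_product N H \<phi>\<^esub> y \<otimes>\<^bsub>semidirect_product N H \<phi>\<^esub> z =
       x \<otimes>\<^bsub>semidirect_product N H \<phi>\<^esub> (y \<otimes>\<^bsub>semidirect_product N H \<phi>\<^esub> z)"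
      by (auto simp: semidirect_product_def cl mu co N.m_assoc H.m_assoc)
  next
    fix x assume "x \<in> carrier (semidirect_product N H \<phi>)"
    then obtain n h where x: "x = (n, h)" "n \<in> carrier N" "h \<in> carrier H"
      by (auto simp: semidirect_product_def)
    have "\<phi> (inv\<^bsub>H\<^esub> h) (inv\<^bsub>N\<^esub> n) \<otimes>\<^bsub>N\<^esub> \<phi> (inv\<^bsub>H\<^esub> h) n = \<phi> (inv\<^bsub>H\<^esub> h) \<one>\<^bsub>N\<^esub>"
      using x by (simp flip: mu)
    also have "\<dots> = \<one>\<^bsub>N\<^esub>"
      using aut[of "inv\<^bsub>H\<^esub> h"] x hom_one[OF _ N N] by (simp add: auto_def)
    finally show "\<exists>y\<in>carrier (semidirect_product N H \<phi>).
        y \<otimes>\<^bsub>semidirect_product N H \<phi>\<^esub> x = \<one>\<^bsub>semidirect_product N H \<phi>\<^esub>"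
      using x
      by (intro bexI[of _ "(\<phi> (inv\<^bsub>H\<^esub> h) (inv\<^bsub>N\<^esub> n), inv\<^bsub>H\<^esub> h)"])
        (auto simp: semidirect_product_def cl)
  qed (auto simp: semidirect_product_def cl on)
qed

lemma involution_apply:
  assumes "\<alpha> \<in> auto G" "\<alpha> [^]\<^bsub>AutoGroup G\<^esub> (2::nat) = \<one>\<^bsub>AutoGroup G\<^esub>" "a \<in> carrier G"
  shows "\<alpha> (\<alpha> a) = a"
proof -
  have \<alpha>: "\<alpha> \<in> Bij (carrier G)" using assms(1) by (simp add: auto_def)
  have "compose (carrier G) \<alpha> \<alpha> = (\<lambda>x\<in>carrier G. x)"
    using assms(2) \<alpha>
    by (simp add: numeral_2_eq_2 nat_pow_def AutoGroup_def BijGroup_def id_Bij Bij_imp_extensional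
        Bij_imp_funcset)
  from fun_cong[OF this, of a] show ?thesis using assms(3) by (simp add: compose_def)
qed

lemma AG_group_AG_of:
  fixes G (structure)
  assumes G: "comm_group G" and \<alpha>: "\<alpha> \<in> auto G"
    and inv: "\<alpha> [^]\<^bsub>AutoGroup G\<^esub> (2::nat) = \<one>\<^bsub>AutoGroup G\<^esub>"
  shows "AG_group (AG_of G \<alpha>)"
proof -
  interpret comm_group G by fact
  have cl: "\<alpha> a \<in> carrier G" if "a \<in> carrier G" for a
    using \<alpha> that by (auto simp: auto_def hom_def)
  have mu: "\<alpha> (a \<otimes> b) = \<alpha> a \<otimes> \<alpha> b" if "a \<in> carrier G" "b \<in> carrier G" for a b
    using \<alpha> that by (auto simp: auto_def hom_def)
  have on: "\<alpha> \<one> = \<one>" using \<alpha> hom_one[OF _ is_group is_group] by (simp add: auto_def)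
  note ii = involution_apply[OF \<alpha> inv]
  show ?thesis
  proof (unfold_locales, goal_cases)
    case (5 x)
    then show ?case
      by (intro bexI[of _ "\<alpha> (inv x)"]) (auto simp: AG_of_def cl ii)
  qed (auto simp: AG_of_def cl mu ii on m_ac)
qed

lemma AG_of_associative_iff:
  fixes G (structure)
  assumes G: "comm_group G" and \<alpha>: "\<alpha> \<in> auto G"
    and inv: "\<alpha> [^]\<^bsub>AutoGroup G\<^esub> (2::nat) = \<one>\<^bsub>AutoGroup G\<^esub>"
  shows "associative_on_carrier (AG_of G \<alpha>) \<longleftrightarrow> \<alpha> = \<one>\<^bsub>AutoGroup G\<^esub>"
proof -
  interpret comm_group G by fact
  have cl: "\<alpha> a \<in> carrier G" if "a \<in> carrier G" for a
    using \<alpha> that by (auto simp: auto_def hom_def)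
  have mu: "\<alpha> (a \<otimes> b) = \<alpha> a \<otimes> \<alpha> b" if "a \<in> carrier G" "b \<in> carrier G" for a b
    using \<alpha> that by (auto simp: auto_def hom_def)
  have on: "\<alpha> \<one> = \<one>" using \<alpha> hom_one[OF _ is_group is_group] by (simp add: auto_def)
  note ii = involution_apply[OF \<alpha> inv]
  have ext: "\<alpha> \<in> extensional (carrier G)" using \<alpha> by (simp add: auto_def Bij_def)
  have one: "\<one>\<^bsub>AutoGroup G\<^esub> = (\<lambda>x\<in>carrier G. x)" by (simp add: AutoGroup_def BijGroup_def)
  show ?thesis
  proof
    assume A: "associative_on_carrier (AG_of G \<alpha>)"
    have "\<alpha> a = a" if a: "a \<in> carrier G" for a
    proof -
      have "\<alpha> (\<alpha> a \<otimes> \<one>) \<otimes> \<one> = \<alpha> a \<otimes> (\<alpha> \<one> \<otimes> \<one>)"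
        using A a by (simp add: associative_on_carrier_def AG_of_def)
      then show ?thesis using a by (simp add: cl ii on)
    qed
    then show "\<alpha> = \<one>\<^bsub>AutoGroup G\<^esub>"
      unfolding one using ext by (auto intro: extensionalityI)
  next
    assume "\<alpha> = \<one>\<^bsub>AutoGroup G\<^esub>"
    then show "associative_on_carrier (AG_of G \<alpha>)"
      by (auto simp: one associative_on_carrier_def AG_of_def m_assoc)
  qed
qed

end

theory Submission
  imports Defs
begin

text \<open>
  Write \<open>\<tau>\<^sub>g\<close> for the translation \<open>z \<mapsto> g \<otimes> z\<close> of the abelian group. Unfolding the operation of the
  AG-group gives \<open>L\<^sub>x = \<tau>\<^bsub>\<alpha> x\<^esub>\<close> and, since the operation of \<open>G\<close> commutes, \<open>R\<^sub>x = \<tau>\<^sub>x \<circ> \<alpha>\<close>. All these are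
  affine maps \<open>\<tau>\<^sub>g \<circ> \<beta>\<close> with linear part \<open>\<beta>\<close> in \<open>\<langle>\<alpha>\<rangle>\<close>. Conversely, \<open>\<alpha>\<close> is onto, so every \<open>\<tau>\<^sub>g\<close> is a left
  translation, and \<open>\<alpha>\<close> itself is \<open>R\<^bsub>\<one>\<^esub>\<close>; hence the multiplication group consists of exactly
  the affine maps with linear part in \<open>\<langle>\<alpha>\<rangle>\<close>.

  For any group \<open>G\<close> and any group \<open>A\<close> of automorphisms, sending \<open>(g, \<beta>)\<close> to \<open>\<tau>\<^sub>g \<circ> \<beta>\<close> embeds \<open>G \<rtimes> A\<close>
  into the permutations of \<open>G\<close> (lemmas \<open>affine_map_hom\<close> and \<open>inj_on_affine_map\<close>): this is the usual
  action of the holomorph. An affine map sends the neutral element to its translation part, so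
  the ones that fix it are those with trivial translation part, which form \<open>A\<close>
  (lemma \<open>affine_maps_fixing_one\<close>). Everything else is the case \<open>A = \<langle>\<alpha>\<rangle> = {1, \<alpha>}\<close>; non-associativity
  says that \<open>\<alpha>\<close> is not the identity, which makes this group have order two.
\<close>

lemma (in group) generate_involution:
  assumes a: "a \<in> carrier G" and aa: "a \<otimes> a = \<one>"
  shows "generate G {a} = {\<one>, a}"
proof
  have "subgroup {\<one>, a} G"
    using a aa by (intro subgroupI) (auto simp: inv_equality)
  then show "generate G {a} \<subseteq> {\<one>, a}"
    by (intro generate_subgroup_incl) auto
  show "{\<one>, a} \<subseteq> generate G {a}"
    by (auto intro: generate.one generate.incl)
qed

definition affine_map :: "('a, 'b) monoid_scheme \<Rightarrow> 'a \<times> ('a \<Rightarrow> 'a) \<Rightarrow> 'a \<Rightarrow> 'a" where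
  "affine_map G p = (\<lambda>z\<in>carrier G. fst p \<otimes>\<^bsub>G\<^esub> snd p z)"

context group
begin

lemma auto_closed: "\<lbrakk>\<beta> \<in> auto G; z \<in> carrier G\<rbrakk> \<Longrightarrow> \<beta> z \<in> carrier G"
  by (auto simp: auto_def hom_def)

lemma auto_mult:
  "\<lbrakk>\<beta> \<in> auto G; x \<in> carrier G; y \<in> carrier G\<rbrakk> \<Longrightarrow> \<beta> (x \<otimes> y) = \<beta> x \<otimes> \<beta> y"
  by (auto simp: auto_def hom_def)

lemma auto_one: "\<beta> \<in> auto G \<Longrightarrow> \<beta> \<one> = \<one>"
  using hom_one[OF _ is_group is_group] by (simp add: auto_def)

lemma affine_map_one_left: "\<beta> \<in> auto G \<Longrightarrow> affine_map G (\<one>, \<beta>) = \<beta>"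
  by (rule extensionalityI[where A = "carrier G"])
    (auto simp: affine_map_def auto_closed, auto simp: auto_def Bij_def)

lemma affine_map_Bij:
  assumes g: "g \<in> carrier G" and \<beta>: "\<beta> \<in> auto G"
  shows "affine_map G (g, \<beta>) \<in> Bij (carrier G)"
proof -
  have b: "bij_betw \<beta> (carrier G) (carrier G)"
    using \<beta> by (simp add: auto_def Bij_def)
  have t: "bij_betw (\<lambda>z. g \<otimes> z) (carrier G) (carrier G)"
    using g by (intro bij_betwI[where g = "\<lambda>z. inv g \<otimes> z"]) (auto simp flip: m_assoc)
  have "bij_betw (affine_map G (g, \<beta>)) (carrier G) (carrier G)"
    using bij_betw_trans[OF b t]
    by (subst bij_betw_cong[where g = "(\<lambda>z. g \<otimes> z) \<circ> \<beta>"]) (auto simp: affine_map_def)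
  then show ?thesis
    by (simp add: Bij_def affine_map_def)
qed

text \<open>This is the identity \<open>\<tau>\<^sub>g \<circ> \<beta> \<circ> \<tau>\<^sub>h \<circ> \<gamma> = \<tau>\<^bsub>g \<otimes> \<beta> h\<^esub> \<circ> (\<beta> \<circ> \<gamma>)\<close>, the reason for the twisted
  multiplication in a semidirect product.\<close>

lemma affine_map_compose:
  assumes "g \<in> carrier G" "\<beta> \<in> auto G" "h \<in> carrier G" "\<gamma> \<in> auto G"
  shows "affine_map G (g \<otimes> \<beta> h, compose (carrier G) \<beta> \<gamma>) =
    compose (carrier G) (affine_map G (g, \<beta>)) (affine_map G (h, \<gamma>))"
  using assms by (auto simp: affine_map_def compose_def fun_eq_iff auto_closed auto_mult m_assoc)

lemma affine_map_hom:
  assumes A: "A \<subseteq> auto G"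
  shows "affine_map G
    \<in> hom (semidirect_product G (AutoGroup G\<lparr>carrier := A\<rparr>) (\<lambda>\<beta>. \<beta>)) (BijGroup (carrier G))"
proof (rule homI)
  let ?S = "semidirect_product G (AutoGroup G\<lparr>carrier := A\<rparr>) (\<lambda>\<beta>. \<beta>)"
  have Bij: "\<beta> \<in> Bij (carrier G)" if "\<beta> \<in> A" for \<beta>
    using A that by (auto simp: auto_def)
  show "affine_map G p \<in> carrier (BijGroup (carrier G))" if "p \<in> carrier ?S" for p
    using that A by (auto simp: semidirect_product_def BijGroup_def intro: affine_map_Bij)
  show "affine_map G (p \<otimes>\<^bsub>?S\<^esub> q) =
      affine_map G p \<otimes>\<^bsub>BijGroup (carrier G)\<^esub> affine_map G q"
    if "p \<in> carrier ?S" "q \<in> carrier ?S" for p q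
    using that A
    by (auto simp: semidirect_product_def AutoGroup_def BijGroup_def Bij affine_map_Bij subset_iff
        affine_map_compose)
qed

text \<open>The value at \<open>\<one>\<close> recovers the translation part, and cancelling it recovers the linear part.\<close>

lemma inj_on_affine_map: "inj_on (affine_map G) (carrier G \<times> auto G)"
proof (rule inj_onI, clarify)
  fix g \<beta> h \<gamma>
  assume g: "g \<in> carrier G" and \<beta>: "\<beta> \<in> auto G" and h: "h \<in> carrier G" and \<gamma>: "\<gamma> \<in> auto G"
    and eq: "affine_map G (g, \<beta>) = affine_map G (h, \<gamma>)"
  have at: "g \<otimes> \<beta> z = h \<otimes> \<gamma> z" if "z \<in> carrier G" for z
    using fun_cong[OF eq, of z] that by (simp add: affine_map_def)
  have gh: "g = h"
    using at[of \<one>] g h \<beta> \<gamma> by (simp add: auto_one)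
  have "\<beta> = \<gamma>"
  proof (rule extensionalityI[where A = "carrier G"])
    show "\<beta> \<in> extensional (carrier G)" "\<gamma> \<in> extensional (carrier G)"
      using \<beta> \<gamma> by (auto simp: auto_def Bij_def)
    show "\<beta> z = \<gamma> z" if "z \<in> carrier G" for z
      using at[OF that] gh that h \<beta> \<gamma> by (simp add: auto_closed)
  qed
  with gh show "g = h \<and> \<beta> = \<gamma>" ..
qed

lemma affine_maps_fixing_one:
  assumes A: "A \<subseteq> auto G"
  shows "{f \<in> affine_map G ` (carrier G \<times> A). f \<one> = \<one>} = A" (is "?F = A")
proof
  show "?F \<subseteq> A"
  proof clarify
    fix g \<beta> assume g: "g \<in> carrier G" and \<beta>: "\<beta> \<in> A" and fix1: "affine_map G (g, \<beta>) \<one> = \<one>"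
    have "\<beta> \<in> auto G" using A \<beta> by blast
    with fix1 g have "g = \<one>" by (simp add: affine_map_def auto_one)
    with \<beta> \<open>\<beta> \<in> auto G\<close> show "affine_map G (g, \<beta>) \<in> A"
      by (simp add: affine_map_one_left)
  qed
  show "A \<subseteq> ?F"
  proof
    fix \<beta> assume \<beta>: "\<beta> \<in> A"
    then have "\<beta> \<in> auto G" using A by blast
    with \<beta> show "\<beta> \<in> ?F"
      by (auto simp: auto_one affine_map_one_left intro!: image_eqI[where x = "(\<one>, \<beta>)"])
  qed
qed

lemma group_semidirect_product_automorphisms:
  assumes "subgroup A (AutoGroup G)"
  shows "group (semidirect_product G (AutoGroup G\<lparr>carrier := A\<rparr>) (\<lambda>\<beta>. \<beta>))"
proof (rule semidirect_product_group[OF is_group])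
  show "group (AutoGroup G\<lparr>carrier := A\<rparr>)"
    using assms AutoGroup by (rule subgroup.subgroup_is_group)
  show "(\<lambda>\<beta>. \<beta>) \<in> hom (AutoGroup G\<lparr>carrier := A\<rparr>) (AutoGroup G)"
    using subgroup.subset[OF assms] by (auto simp: hom_def)
qed

lemma subgroup_affine_maps:
  assumes A: "subgroup A (AutoGroup G)"
  shows "subgroup (affine_map G ` (carrier G \<times> A)) (BijGroup (carrier G))"
proof -
  have "A \<subseteq> auto G"
    using subgroup.subset[OF A] by (simp add: AutoGroup_def)
  then have "group_hom (semidirect_product G (AutoGroup G\<lparr>carrier := A\<rparr>) (\<lambda>\<beta>. \<beta>))
      (BijGroup (carrier G)) (affine_map G)"
    by (intro group_hom.intro group_hom_axioms.intro group_semidirect_product_automorphisms A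
        group_BijGroup affine_map_hom)
  from group_hom.img_is_subgroup[OF this] show ?thesis
    by (simp add: semidirect_product_def)
qed

lemma affine_maps_iso_semidirect_product:
  assumes A: "subgroup A (AutoGroup G)"
  shows "BijGroup (carrier G)\<lparr>carrier := affine_map G ` (carrier G \<times> A)\<rparr>
    \<cong> semidirect_product G (AutoGroup G\<lparr>carrier := A\<rparr>) (\<lambda>\<beta>. \<beta>)" (is "?M \<cong> ?S")
proof -
  have sub: "A \<subseteq> auto G"
    using subgroup.subset[OF A] by (simp add: AutoGroup_def)
  have car: "carrier ?S = carrier G \<times> A"
    by (simp add: semidirect_product_def)
  have "affine_map G \<in> hom ?S ?M"
    using affine_map_hom[OF sub] by (auto simp: hom_def car)
  moreover have "bij_betw (affine_map G) (carrier ?S) (carrier ?M)"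
    using inj_on_subset[OF inj_on_affine_map Sigma_mono[OF subset_refl sub]]
    by (simp add: bij_betw_def car)
  ultimately have "?S \<cong> ?M"
    by (auto simp: is_iso_def iso_def)
  then show ?thesis
    by (rule group.iso_sym[OF group_semidirect_product_automorphisms[OF A]])
qed

end

lemma multiplication_group_AG_of:
  fixes G (structure)
  assumes G: "comm_group G" and \<alpha>: "\<alpha> \<in> auto G"
    and inv: "\<alpha> [^]\<^bsub>AutoGroup G\<^esub> (2::nat) = \<one>\<^bsub>AutoGroup G\<^esub>"
  shows "multiplication_group (AG_of G \<alpha>) = BijGroup (carrier G)
    \<lparr>carrier := affine_map G ` (carrier G \<times> carrier (cyclic_aut_group G \<alpha>))\<rparr>"
proof -
  interpret comm_group G by fact
  interpret Aut: group "AutoGroup G" by (rule AutoGroup)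
  interpret Sym: group "BijGroup (carrier G)" by (rule group_BijGroup)
  let ?A = "generate (AutoGroup G) {\<alpha>}"
  let ?L = "left_translation (AG_of G \<alpha>)" and ?R = "right_translation (AG_of G \<alpha>)"
  let ?T = "?L ` carrier G \<union> ?R ` carrier G"
  let ?M = "generate (BijGroup (carrier G)) ?T"
  have \<alpha>_Aut: "\<alpha> \<in> carrier (AutoGroup G)"
    using \<alpha> by (simp add: AutoGroup_def)
  have A: "subgroup ?A (AutoGroup G)"
    using \<alpha>_Aut by (intro Aut.generate_is_subgroup) auto
  have "\<alpha> \<otimes>\<^bsub>AutoGroup G\<^esub> \<alpha> = \<one>\<^bsub>AutoGroup G\<^esub>"
    using inv \<alpha>_Aut by (simp add: numeral_2_eq_2)
  then have A_eq: "?A = {\<one>\<^bsub>AutoGroup G\<^esub>, \<alpha>}"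
    using \<alpha>_Aut by (intro Aut.generate_involution)
  have one: "\<one>\<^bsub>AutoGroup G\<^esub> = (\<lambda>z\<in>carrier G. z)"
    by (simp add: AutoGroup_def BijGroup_def)
  have L: "?L x = affine_map G (\<alpha> x, \<one>\<^bsub>AutoGroup G\<^esub>)" for x
    by (auto simp: left_translation_def AG_of_def affine_map_def one)
  have R: "?R x = affine_map G (x, \<alpha>)" if "x \<in> carrier G" for x
    using \<alpha> that
    by (auto simp: right_translation_def AG_of_def affine_map_def auto_closed m_comm fun_eq_iff)
  have T: "?T \<subseteq> affine_map G ` (carrier G \<times> ?A)"
    using \<alpha> by (auto simp: L R A_eq auto_closed)
  have T_Bij: "?T \<subseteq> carrier (BijGroup (carrier G))"
    using T subgroup.subset[OF subgroup_affine_maps[OF A]] by blast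
  have M: "subgroup ?M (BijGroup (carrier G))"
    by (rule Sym.generate_is_subgroup[OF T_Bij])
  have "?M = affine_map G ` (carrier G \<times> ?A)"
  proof
    show "?M \<subseteq> affine_map G ` (carrier G \<times> ?A)"
      by (rule Sym.generate_subgroup_incl[OF T subgroup_affine_maps[OF A]])
    have trans: "affine_map G (g, \<one>\<^bsub>AutoGroup G\<^esub>) \<in> ?M" if "g \<in> carrier G" for g
    proof -
      have "?L (\<alpha> g) = affine_map G (g, \<one>\<^bsub>AutoGroup G\<^esub>)"
        using that by (simp add: L involution_apply[OF \<alpha> inv])
      moreover have "?L (\<alpha> g) \<in> ?T" using \<alpha> that by (simp add: auto_closed)
      ultimately show ?thesis by (metis generate.incl)
    qed
    \<comment> \<open>These are the right translations, so no product of generators has to be formed.\<close>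
    have twisted: "affine_map G (g, \<alpha>) \<in> ?M" if "g \<in> carrier G" for g
      using that by (auto simp flip: R intro: generate.incl)
    show "affine_map G ` (carrier G \<times> ?A) \<subseteq> ?M"
      using trans twisted by (auto simp: A_eq)
  qed
  then show ?thesis
    by (simp add: multiplication_group_def cyclic_aut_group_def AG_of_def)
qed

theorem theorem3:
  fixes G :: "('a, 'b) monoid_scheme" and \<alpha> :: "'a \<Rightarrow> 'a"
  assumes "comm_group G"
    and "\<alpha> \<in> carrier (AutoGroup G)"
    and "\<alpha> [^]\<^bsub>AutoGroup G\<^esub> (2::nat) = \<one>\<^bsub>AutoGroup G\<^esub>"
    and "\<not> associative_on_carrier (AG_of G \<alpha>)"
  shows "multiplication_group (AG_of G \<alpha>)
           \<cong> semidirect_product G (cyclic_aut_group G \<alpha>) (\<lambda>\<beta>. \<beta>)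
         \<and> order (cyclic_aut_group G \<alpha>) = 2
         \<and> inner_mapping_group (AG_of G \<alpha>) = carrier (cyclic_aut_group G \<alpha>)"
proof -
  interpret comm_group G by fact
  interpret Aut: group "AutoGroup G" by (rule AutoGroup)
  have \<alpha>: "\<alpha> \<in> auto G"
    using assms(2) by (simp add: AutoGroup_def)
  note M = multiplication_group_AG_of[OF assms(1) \<alpha> assms(3)]
  let ?A = "generate (AutoGroup G) {\<alpha>}"
  have A: "subgroup ?A (AutoGroup G)"
    using assms(2) by (intro Aut.generate_is_subgroup) auto
  then have sub: "?A \<subseteq> auto G"
    using subgroup.subset by (fastforce simp: AutoGroup_def)
  have "multiplication_group (AG_of G \<alpha>)
      \<cong> semidirect_product G (cyclic_aut_group G \<alpha>) (\<lambda>\<beta>. \<beta>)"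
    unfolding M using affine_maps_iso_semidirect_product[OF A] by (simp add: cyclic_aut_group_def)
  moreover have "order (cyclic_aut_group G \<alpha>) = 2"
  proof -
    have "\<alpha> \<noteq> \<one>\<^bsub>AutoGroup G\<^esub>"
      using assms(4) AG_of_associative_iff[OF assms(1) \<alpha> assms(3)] by simp
    moreover have "?A = {\<one>\<^bsub>AutoGroup G\<^esub>, \<alpha>}"
      using assms(2,3) by (intro Aut.generate_involution) (simp_all add: numeral_2_eq_2)
    ultimately show ?thesis
      by (simp add: order_def cyclic_aut_group_def card_insert_if)
  qed
  moreover have "inner_mapping_group (AG_of G \<alpha>) = carrier (cyclic_aut_group G \<alpha>)"
    unfolding inner_mapping_group_def M stabilizer_def
    using affine_maps_fixing_one[OF sub] by (simp add: cyclic_aut_group_def AG_of_def)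
  ultimately show ?thesis by blast
qed

end
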